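(* The $\mathcal{P}$-positions of (single-heap) Mem$^0$ are exactly the positions of the form $n_n$ with $v_2(n)\equiv 0\pmod 2$, where all empty-heap positions $0_k$ ($k \ge 0$) are identified with $0_0$.
   Context: Mem$^0$ is an impartial game under normal play (a player unable to move loses), played on a heap of tokens. A position $n_k$ (integers $n,k\ge 0$) is a heap of $n$ tokens with memory $k$, where $k$ is the number of tokens removed by the immediately preceding move on the heap ($k=0$ for an untouched heap). From $n_k$ a player may move to $(n-j)_j$ for any integer $j$ with $1\le j\le n$ and $j\ne k$; there are no other moves. A position is a $\mathcal{P}$-position if the previous player (the one not about to move) has a winning strategy. For a positive integer $n=2^e q$ with $q$ odd, $v_2(n)=e$ is the dyadic valuation; by convention $v_2(0)$ is considered even. Every empty-heap position $0_k$ is terminal. *)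

theory Defs
  imports "HOL-Computational_Algebra.Primes"
begin

text \<open>Impartial games under normal play, given by a move relation on positions.
  A play is recorded as the non-empty list of positions visited, oldest first.\<close>

definition play_from :: "('a \<Rightarrow> 'a \<Rightarrow> bool) \<Rightarrow> 'a \<Rightarrow> 'a list \<Rightarrow> bool" where
  "play_from mv p xs \<longleftrightarrow> xs \<noteq> [] \<and> hd xs = p \<and> successively mv xs"

definition terminal :: "('a \<Rightarrow> 'a \<Rightarrow> bool) \<Rightarrow> 'a \<Rightarrow> bool" where
  "terminal mv p \<longleftrightarrow> (\<nexists>q. mv p q)"

text \<open>Strategies may depend on the whole history of the play, whose last entry is the
  current position; a strategy must choose a legal move whenever there is one.\<close>

definition strategy :: "('a \<Rightarrow> 'a \<Rightarrow> bool) \<Rightarrow> ('a list \<Rightarrow> 'a) \<Rightarrow> bool" where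
  "strategy mv s \<longleftrightarrow> (\<forall>h. h \<noteq> [] \<and> \<not> terminal mv (last h) \<longrightarrow> mv (last h) (s h))"

text \<open>The next player moves from the positions with even index \<open>0, 2, 4, \<dots>\<close>, the previous
  player from those with odd index.\<close>

definition previous_follows :: "('a list \<Rightarrow> 'a) \<Rightarrow> 'a list \<Rightarrow> bool" where
  "previous_follows s xs \<longleftrightarrow> (\<forall>i. odd i \<and> Suc i < length xs \<longrightarrow> xs ! Suc i = s (take (Suc i) xs))"

text \<open>A completed play consisting of \<open>length xs - 1\<close> moves is lost by the player who is then
  to move; this is the next player iff \<open>length xs\<close> is odd.  Only finite plays are considered,
  so this is the intended notion for games without infinite plays.\<close>

definition P_position :: "('a \<Rightarrow> 'a \<Rightarrow> bool) \<Rightarrow> 'a \<Rightarrow> bool" where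
  "P_position mv p \<longleftrightarrow>
     (\<exists>s. strategy mv s \<and>
       (\<forall>xs. play_from mv p xs \<and> previous_follows s xs \<and> terminal mv (last xs)
          \<longrightarrow> odd (length xs)))"

text \<open>The pair \<open>(n, k)\<close> stands for the heap of \<open>n\<close> tokens with memory \<open>k\<close>.\<close>

type_synonym mem_position = "nat \<times> nat"

inductive mem0_move :: "mem_position \<Rightarrow> mem_position \<Rightarrow> bool" where
  "\<lbrakk>1 \<le> j; j \<le> n; j \<noteq> k\<rbrakk> \<Longrightarrow> mem0_move (n, k) (n - j, j)"

lemma wfp_mem0_move: "wfp (mem0_move\<inverse>\<inverse>)"
proof -
  have "wfp (\<lambda>p q :: mem_position. fst p < fst q)"
    by (rule wfp_if_convertible_to_nat[of _ fst]) simp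
  then show ?thesis
    by (rule wfp_subset) (auto elim!: mem0_move.cases)
qed

definition identify_empty :: "mem_position \<Rightarrow> mem_position" where
  "identify_empty p = (if fst p = 0 then (0, 0) else p)"

text \<open>Since \<open>multiplicity p 0 = 0\<close> in the library, the valuation of \<open>0\<close> counts as even.\<close>

abbreviation v2 :: "nat \<Rightarrow> nat" where
  "v2 n \<equiv> multiplicity 2 n"

end

theory Submission
  imports Defs
begin

text \<open>In a game without infinite plays, the \<open>\<P>\<close>-positions are the unique kernel of the move
  graph: the set \<open>K\<close> of positions from which no move leads into \<open>K\<close> (lemma
  \<open>P_position_iff_kernel\<close>). The player facing a position of \<open>K\<close> has to leave it, the opponent
  can return to it, and the play ends in \<open>K\<close>, since every terminal position lies there.

  It then remains to see that the claimed set is a kernel for Mem\<open>\<^sup>0\<close>. From a heap of \<open>n > 0\<close>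
  tokens with memory other than \<open>n\<close> one wins at once by taking everything, so only the empty
  heap and the positions \<open>n\<^sub>n\<close> can be in the kernel. From \<open>n\<^sub>n\<close> with \<open>n > 0\<close> a
  move to \<open>(n - j)\<^sub>j\<close> cannot empty the heap, and hence can reach the kernel only if \<open>n - j = j\<close>. So \<open>n\<^sub>n\<close> is outside the
  kernel iff \<open>n = 2j\<close> for some \<open>j\<close> with \<open>j\<^sub>j\<close> in the kernel. As halving lowers the dyadic
  valuation by one, this recursion selects the \<open>n\<close> of even valuation.\<close>

lemma previous_follows_snoc:
  assumes "h \<noteq> []"
  shows "previous_follows s (h @ [q]) \<longleftrightarrow>
    previous_follows s h \<and> (even (length h) \<longrightarrow> q = s h)"
proof
  assume L: "previous_follows s (h @ [q])"
  show "previous_follows s h \<and> (even (length h) \<longrightarrow> q = s h)"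
  proof (intro conjI impI)
    show "previous_follows s h"
      unfolding previous_follows_def
    proof (intro allI impI)
      fix i assume i: "odd i \<and> Suc i < length h"
      then have "(h @ [q]) ! Suc i = s (take (Suc i) (h @ [q]))"
        using L unfolding previous_follows_def by simp
      then show "h ! Suc i = s (take (Suc i) h)"
        using i by (simp add: nth_append)
    qed
    assume "even (length h)"
    moreover obtain m where m: "length h = Suc m"
      using assms by (cases h) auto
    ultimately have "(h @ [q]) ! Suc m = s (take (Suc m) (h @ [q]))"
      using L unfolding previous_follows_def by simp
    then show "q = s h"
      using m by (simp add: nth_append)
  qed
next
  assume R: "previous_follows s h \<and> (even (length h) \<longrightarrow> q = s h)"
  show "previous_follows s (h @ [q])"
    unfolding previous_follows_def
  proof (intro allI impI)
    fix i assume i: "odd i \<and> Suc i < length (h @ [q])"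
    show "(h @ [q]) ! Suc i = s (take (Suc i) (h @ [q]))"
    proof (cases "Suc i < length h")
      case True
      then show ?thesis
        using R i unfolding previous_follows_def by (simp add: nth_append)
    next
      case False
      then have "Suc i = length h"
        using i by simp
      moreover from this have "even (length h)"
        using i by (metis even_Suc)
      ultimately show ?thesis
        using R by (simp add: nth_append)
    qed
  qed
qed

lemma play_from_snoc:
  assumes "h \<noteq> []"
  shows "play_from mv p (h @ [q]) \<longleftrightarrow> play_from mv p h \<and> mv (last h) q"
  using assms by (auto simp: play_from_def successively_append_iff)

text \<open>The previous player wins from the kernel by always moving back into it. The play then
  is in the kernel exactly when the next player is to move, and a play that stops does so in
  the kernel.\<close>

lemma P_position_if_kernel:
  assumes kernel: "\<And>p. K p \<longleftrightarrow> (\<forall>q. mv p q \<longrightarrow> \<not> K q)"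
    and "K p"
  shows "P_position mv p"
proof -
  \<comment> \<open>The last branch only makes \<open>s\<close> legal at histories that its own plays never reach.\<close>
  define s where "s h = (if \<exists>q. mv (last h) q \<and> K q
      then SOME q. mv (last h) q \<and> K q else SOME q. mv (last h) q)" for h
  have into_K: "mv (last h) (s h) \<and> K (s h)" if "\<not> K (last h)" for h
  proof -
    have "\<exists>q. mv (last h) q \<and> K q"
      using that kernel by blast
    then show ?thesis
      unfolding s_def by (simp add: someI_ex[of "\<lambda>q. mv (last h) q \<and> K q"])
  qed
  have "strategy mv s"
    unfolding strategy_def
  proof (intro allI impI)
    fix h assume "h \<noteq> [] \<and> \<not> terminal mv (last h)"
    then have ex: "\<exists>q. mv (last h) q"
      by (simp add: terminal_def)
    show "mv (last h) (s h)"
    proof (cases "K (last h)")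
      case True
      then have "s h = (SOME q. mv (last h) q)"
        using kernel[of "last h"] unfolding s_def by (metis (mono_tags, lifting))
      then show ?thesis
        using someI_ex[OF ex] by simp
    qed (use into_K in blast)
  qed
  moreover have parity: "K (last xs) \<longleftrightarrow> odd (length xs)"
    if "play_from mv p xs" "previous_follows s xs" for xs
    using that
  proof (induction xs rule: rev_induct)
    case Nil
    then show ?case by (simp add: play_from_def)
  next
    case (snoc q h)
    show ?case
    proof (cases "h = []")
      case True
      then show ?thesis
        using snoc.prems \<open>K p\<close> by (simp add: play_from_def)
    next
      case False
      have IH: "K (last h) \<longleftrightarrow> odd (length h)" and step: "mv (last h) q"
        and reply: "even (length h) \<Longrightarrow> q = s h"
        using snoc False by (simp_all add: play_from_snoc previous_follows_snoc)
      show ?thesis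
      proof (cases "even (length h)")
        case True
        then show ?thesis
          using IH reply into_K by simp
      next
        case odd: False
        then have "\<not> K q"
          using IH step kernel[of "last h"] by blast
        then show ?thesis
          using odd by simp
      qed
    qed
  qed
  ultimately show ?thesis
    using kernel unfolding P_position_def terminal_def by blast
qed

text \<open>A play against a strategy \<open>s\<close> of the previous player, in which the kernel is occupied
  exactly when the previous player is to move, can be continued with this invariant until it
  stops: the next player moves into the kernel, and every answer of \<open>s\<close> leaves it. Stating
  this for both parities lets the induction advance by single moves.\<close>

lemma losing_play_against_strategy:
  assumes kernel: "\<And>p. K p \<longleftrightarrow> (\<forall>q. mv p q \<longrightarrow> \<not> K q)"
    and wf: "wfp (mv\<inverse>\<inverse>)"
    and s: "strategy mv s"
    and "play_from mv p h" "previous_follows s h" "K (last h) \<longleftrightarrow> even (length h)"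
  shows "\<exists>xs. play_from mv p xs \<and> previous_follows s xs \<and> terminal mv (last xs)
    \<and> even (length xs)"
  using assms(4-)
proof (induction "last h" arbitrary: h rule: wfp_induct_rule[OF wf])
  case 1
  note play = "1.prems"(1,2) and inv = "1.prems"(3)
  have ne: "h \<noteq> []"
    using play by (simp add: play_from_def)
  show ?case
  proof (cases "terminal mv (last h)")
    case True
    then have "K (last h)"
      using kernel[of "last h"] unfolding terminal_def by blast
    then show ?thesis
      using play inv True by blast
  next
    case False
    have "\<exists>q. mv (last h) q \<and> (even (length h) \<longrightarrow> q = s h) \<and> (K q \<longleftrightarrow> odd (length h))"
    proof (cases "even (length h)")
      case True
      then have "mv (last h) (s h)"
        using s ne False unfolding strategy_def by blast
      then show ?thesis
        using True inv kernel[of "last h"] by blast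
    next
      case odd: False
      then show ?thesis
        using inv kernel[of "last h"] by blast
    qed
    then obtain q where "mv (last h) q" "even (length h) \<longrightarrow> q = s h" "K q \<longleftrightarrow> odd (length h)"
      by blast
    then show ?thesis
      using play ne by (intro "1.hyps"[of "h @ [q]"])
        (simp_all add: play_from_snoc previous_follows_snoc)
  qed
qed

theorem P_position_iff_kernel:
  assumes kernel: "\<And>p. K p \<longleftrightarrow> (\<forall>q. mv p q \<longrightarrow> \<not> K q)"
    and wf: "wfp (mv\<inverse>\<inverse>)"
  shows "P_position mv p \<longleftrightarrow> K p"
proof
  assume "P_position mv p"
  then obtain s where s: "strategy mv s"
    and win: "\<And>xs. play_from mv p xs \<Longrightarrow> previous_follows s xs \<Longrightarrow> terminal mv (last xs)
      \<Longrightarrow> odd (length xs)"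
    unfolding P_position_def by blast
  show "K p"
  proof (rule ccontr)
    assume "\<not> K p"
    then have "\<exists>xs. play_from mv p xs \<and> previous_follows s xs \<and> terminal mv (last xs)
        \<and> even (length xs)"
      by (intro losing_play_against_strategy[OF kernel wf s, of p "[p]"])
        (simp_all add: play_from_def previous_follows_def)
    then show False
      using win by blast
  qed
qed (rule P_position_if_kernel[OF kernel])

lemma mem0_move_iff:
  "mem0_move (n, k) q \<longleftrightarrow> (\<exists>j. 1 \<le> j \<and> j \<le> n \<and> j \<noteq> k \<and> q = (n - j, j))"
  by (auto simp: mem0_move.simps)

lemma even_v2_iff_no_half:
  assumes "n > 0"
  shows "even (v2 n) \<longleftrightarrow> (\<forall>j. n = 2 * j \<longrightarrow> odd (v2 j))"
proof (cases "even n")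
  case True
  then obtain j where j: "n = 2 * j"
    by (elim evenE)
  then have "v2 n = Suc (v2 j)"
    using assms by (simp add: multiplicity_times_same)
  then show ?thesis
    using j by auto
next
  case False
  then show ?thesis
    by (auto simp: not_dvd_imp_multiplicity_0)
qed

definition mem0_kernel :: "mem_position \<Rightarrow> bool" where
  "mem0_kernel p \<longleftrightarrow> fst p = 0 \<or> fst p = snd p \<and> even (v2 (fst p))"

lemma mem0_kernel_iff_no_move_to_kernel:
  "mem0_kernel p \<longleftrightarrow> (\<forall>q. mem0_move p q \<longrightarrow> \<not> mem0_kernel q)"
proof (cases p)
  case (Pair n k)
  consider "n = 0" | "n > 0" "n \<noteq> k" | "n > 0" "n = k"
    by blast
  then show ?thesis
  proof cases
    case 1
    then show ?thesis
      by (simp add: Pair mem0_kernel_def mem0_move_iff)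
  next
    case 2
    then have "mem0_move p (0, n)" "mem0_kernel (0, n)"
      by (auto simp: Pair mem0_kernel_def mem0_move_iff)
    moreover have "\<not> mem0_kernel p"
      using 2 by (simp add: Pair mem0_kernel_def)
    ultimately show ?thesis
      by blast
  next
    case 3
    have "(\<exists>q. mem0_move p q \<and> mem0_kernel q) \<longleftrightarrow> (\<exists>j. n = 2 * j \<and> even (v2 j))"
    proof
      assume "\<exists>q. mem0_move p q \<and> mem0_kernel q"
      then obtain j where "1 \<le> j" "j \<le> n" "j \<noteq> n" "mem0_kernel (n - j, j)"
        using 3 by (auto simp: Pair mem0_move_iff)
      then have "n = 2 * j \<and> even (v2 j)"
        by (auto simp: mem0_kernel_def)
      then show "\<exists>j. n = 2 * j \<and> even (v2 j)" ..
    next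
      assume "\<exists>j. n = 2 * j \<and> even (v2 j)"
      then obtain j where "n = 2 * j" "even (v2 j)"
        by blast
      then have "mem0_move p (j, j) \<and> mem0_kernel (j, j)"
        using 3 by (auto simp: Pair mem0_move_iff mem0_kernel_def)
      then show "\<exists>q. mem0_move p q \<and> mem0_kernel q" ..
    qed
    moreover have "mem0_kernel p \<longleftrightarrow> even (v2 n)"
      using 3 by (simp add: Pair mem0_kernel_def)
    ultimately show ?thesis
      using even_v2_iff_no_half[OF \<open>n > 0\<close>] by blast
  qed
qed

lemma mem0_kernel_iff_identify_empty:
  "mem0_kernel p \<longleftrightarrow> (\<exists>n. identify_empty p = (n, n) \<and> v2 n mod 2 = 0)"
  by (cases p) (auto simp: mem0_kernel_def identify_empty_def even_iff_mod_2_eq_zero)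

theorem theorem4p2:
  "{p. P_position mem0_move p} =
   {p. \<exists>n. identify_empty p = (n, n) \<and> v2 n mod 2 = 0}"
  using P_position_iff_kernel[OF mem0_kernel_iff_no_move_to_kernel wfp_mem0_move]
  by (simp add: mem0_kernel_iff_identify_empty)

end
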